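(* Let $M=\langle W,\Sigma,V\rangle$ and $M'=\langle W',\Sigma',V'\rangle$ be image-finite in-models. Then: (1) for worlds $w\in W$, $w'\in W'$, if $M,w\equiv M',w'$ then $M,w\sim M',w'$; (2) for finite states $s\subseteq W$, $s'\subseteq W'$, if $M,s\equiv M',s'$ then $M,s\sim M',s'$.
   Context: Fix a set $\mathcal P$ of atoms. Formulas of $\mathcal L_{\Rrightarrow}$ are given by $\varphi ::= p \mid \bot \mid (\varphi\wedge\varphi)\mid(\varphi\to\varphi)\mid(\varphi\veebar\varphi)\mid(\varphi\Rrightarrow\varphi)$ with $p\in\mathcal P$, where $\veebar$ denotes inquisitive disjunction. An in-model is $M=\langle W,\Sigma,V\rangle$ where $W$ is a nonempty set, $\Sigma$ assigns to each $w\in W$ a set $\Sigma(w)$ of nonempty subsets of $W$, and $V:W\times\mathcal P\to\{0,1\}$. It is image-finite if $\bigcup\Sigma(w)$ is finite for every $w\in W$. Support at $s\subseteq W$: $M,s\models p$ iff $V(w,p)=1$ for all $w\in s$; $M,s\models\bot$ iff $s=\emptyset$; $M,s\models\varphi\wedge\psi$ iff both; $M,s\models\varphi\veebar\psi$ iff $M,s\models\varphi$ or $M,s\models\psi$; $M,s\models\varphi\to\psi$ iff for all $t\subseteq s$, $M,t\models\varphi$ implies $M,t\models\psi$; $M,s\models\varphi\Rrightarrow\psi$ iff for all $w\in s$ and $t\in\Sigma(w)$, $M,t\models\varphi$ implies $M,t\models\psi$. Truth: $M,w\models\varphi$ iff $M,\{w\}\models\varphi$. $M,w\equiv M',w'$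 means $w,w'$ make true the same formulas of $\mathcal L_{\Rrightarrow}$; $M,s\equiv M',s'$ means $s,s'$ support the same formulas. Egli-Milner lifting of $R\subseteq X\times Y$: $A\overline R B$ iff every $a\in A$ has $b\in B$ with $aRb$ and every $b\in B$ has $a\in A$ with $aRb$. A bisimulation between $M$ and $M'$ is a nonempty relation $Z\subseteq W\times W'$ such that whenever $wZw'$: $V(w,p)=V'(w',p)$ for all $p\in\mathcal P$; for every $s\in\Sigma(w)$ there is $s'\in\Sigma'(w')$ with $s\overline Zs'$; for every $s'\in\Sigma'(w')$ there is $s\in\Sigma(w)$ with $s\overline Zs'$. $M,w\sim M',w'$ iff some bisimulation $Z$ has $wZw'$; $M,s\sim M',s'$ iff some bisimulation $Z$ has $s\overline Zs'$.
   Formalization: In part (2) the states s and s' are assumed not both empty: bisimulations are nonempty by definition, so for s = s' = ∅ the claim fails (two one-world models without neighbourhoods that disagree on an atom). *)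

theory Defs
  imports Main
begin

datatype 'p form =
    Atom 'p
  | Bot
  | And "'p form" "'p form"
  | Imp "'p form" "'p form"
  | InqDisj "'p form" "'p form"
  | InqCond "'p form" "'p form"  (* the modal conditional \<Rrightarrow> *)

record ('w, 'p) in_struct =
  worlds :: "'w set"
  nbhds :: "'w \<Rightarrow> 'w set set"
  val :: "'w \<Rightarrow> 'p \<Rightarrow> bool"

definition in_model :: "('w, 'p) in_struct \<Rightarrow> bool" where
  "in_model M \<longleftrightarrow>
     worlds M \<noteq> {} \<and>
     (\<forall>w\<in>worlds M. \<forall>s\<in>nbhds M w. s \<noteq> {} \<and> s \<subseteq> worlds M)"

definition image_finite :: "('w, 'p) in_struct \<Rightarrow> bool" where
  "image_finite M \<longleftrightarrow> (\<forall>w\<in>worlds M. finite (\<Union>(nbhds M w)))"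

fun supports :: "('w, 'p) in_struct \<Rightarrow> 'w set \<Rightarrow> 'p form \<Rightarrow> bool" where
  "supports M s (Atom p) \<longleftrightarrow> (\<forall>w\<in>s. val M w p)"
| "supports M s Bot \<longleftrightarrow> s = {}"
| "supports M s (And \<phi> \<psi>) \<longleftrightarrow> supports M s \<phi> \<and> supports M s \<psi>"
| "supports M s (Imp \<phi> \<psi>) \<longleftrightarrow> (\<forall>t. t \<subseteq> s \<longrightarrow> supports M t \<phi> \<longrightarrow> supports M t \<psi>)"
| "supports M s (InqDisj \<phi> \<psi>) \<longleftrightarrow> supports M s \<phi> \<or> supports M s \<psi>"
| "supports M s (InqCond \<phi> \<psi>) \<longleftrightarrow>
     (\<forall>w\<in>s. \<forall>t\<in>nbhds M w. supports M t \<phi> \<longrightarrow> supports M t \<psi>)"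

definition true_at :: "('w, 'p) in_struct \<Rightarrow> 'w \<Rightarrow> 'p form \<Rightarrow> bool" where
  "true_at M w \<phi> \<longleftrightarrow> supports M {w} \<phi>"

definition world_equiv ::
  "('w, 'p) in_struct \<Rightarrow> 'w \<Rightarrow> ('v, 'p) in_struct \<Rightarrow> 'v \<Rightarrow> bool" where
  "world_equiv M w M' w' \<longleftrightarrow> (\<forall>\<phi>. true_at M w \<phi> \<longleftrightarrow> true_at M' w' \<phi>)"

definition state_equiv ::
  "('w, 'p) in_struct \<Rightarrow> 'w set \<Rightarrow> ('v, 'p) in_struct \<Rightarrow> 'v set \<Rightarrow> bool" where
  "state_equiv M s M' s' \<longleftrightarrow> (\<forall>\<phi>. supports M s \<phi> \<longleftrightarrow> supports M' s' \<phi>)"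

text \<open>The library's \<^const>\<open>rel_set\<close> is the Egli-Milner lifting.\<close>

definition bisimulation ::
  "('w, 'p) in_struct \<Rightarrow> ('v, 'p) in_struct \<Rightarrow> ('w \<Rightarrow> 'v \<Rightarrow> bool) \<Rightarrow> bool" where
  "bisimulation M M' Z \<longleftrightarrow>
     (\<exists>w w'. Z w w') \<and>
     (\<forall>w w'. Z w w' \<longrightarrow>
        w \<in> worlds M \<and> w' \<in> worlds M' \<and>
        (\<forall>p. val M w p \<longleftrightarrow> val M' w' p) \<and>
        (\<forall>s\<in>nbhds M w. \<exists>s'\<in>nbhds M' w'. rel_set Z s s') \<and>
        (\<forall>s'\<in>nbhds M' w'. \<exists>s\<in>nbhds M w. rel_set Z s s'))"

definition world_bisimilar ::
  "('w, 'p) in_struct \<Rightarrow> 'w \<Rightarrow> ('v, 'p) in_struct \<Rightarrow> 'v \<Rightarrow> bool" where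
  "world_bisimilar M w M' w' \<longleftrightarrow> (\<exists>Z. bisimulation M M' Z \<and> Z w w')"

definition state_bisimilar ::
  "('w, 'p) in_struct \<Rightarrow> 'w set \<Rightarrow> ('v, 'p) in_struct \<Rightarrow> 'v set \<Rightarrow> bool" where
  "state_bisimilar M s M' s' \<longleftrightarrow> (\<exists>Z. bisimulation M M' Z \<and> rel_set Z s s')"

text \<open>Bisimulations are nonempty by definition, so two empty states are bisimilar only if some
  pair of worlds is. Since empty states support all formulas, the Hennessy-Milner property for
  states needs the proviso that the two states are not both empty:\<close>

lemma supports_empty: "supports M {} \<phi>"
  by (induction \<phi>) auto

lemma empty_states_equiv: "state_equiv M {} M' {}"
  by (simp add: state_equiv_def supports_empty)

lemma empty_states_not_bisimilar:
  fixes M M' :: "(unit, 'p) in_struct"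
  assumes "M = \<lparr>worlds = UNIV, nbhds = \<lambda>_. {}, val = \<lambda>_ _. True\<rparr>"
    and "M' = \<lparr>worlds = UNIV, nbhds = \<lambda>_. {}, val = \<lambda>_ _. False\<rparr>"
  shows "in_model M \<and> image_finite M \<and> in_model M' \<and> image_finite M' \<and>
    state_equiv M {} M' {} \<and> \<not> state_bisimilar M {} M' {}"
  using empty_states_equiv[of M M']
  by (auto simp: assms in_model_def image_finite_def state_bisimilar_def bisimulation_def)

end

theory Submission
  imports Defs
begin

text \<open>Equivalence of worlds is itself a bisimulation. If a neighborhood \<open>s\<close> of \<open>w\<close> is equivalent
  to none of the finitely many neighborhoods \<open>t\<close> of \<open>w'\<close>, then for each \<open>t\<close> there is a formula
  supported by exactly one of \<open>s\<close> and \<open>t\<close>. With \<open>\<phi>\<close> the conjunction of those supported by \<open>s\<close> and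
  \<open>\<psi>\<close> the inquisitive disjunction of the others, \<open>InqCond \<phi> \<psi>\<close> holds at \<open>w'\<close> and fails at \<open>w\<close>.
  Hence equivalent worlds have equivalent neighborhoods. Finite equivalent states are in turn
  related by the lifting of world equivalence: double negation makes a formula truth-conditional,
  so if every world of a finite state can be separated from a given world, then a single formula
  supported by the state does so.\<close>

lemma supports_antimono: "supports M s \<phi> \<Longrightarrow> t \<subseteq> s \<Longrightarrow> supports M t \<phi>"
proof (induction \<phi> arbitrary: s t)
  case (Imp \<phi> \<psi>)
  from Imp.prems show ?case by simp
qed auto

lemma supports_imp_true_at: "supports M s \<phi> \<Longrightarrow> w \<in> s \<Longrightarrow> true_at M w \<phi>"
  unfolding true_at_def by (rule supports_antimono) simp_all

definition Neg :: "'p form \<Rightarrow> 'p form" where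
  "Neg \<phi> = Imp \<phi> Bot"

lemma supports_Neg: "supports M s (Neg \<phi>) \<longleftrightarrow> (\<forall>w\<in>s. \<not> true_at M w \<phi>)"
proof
  assume "supports M s (Neg \<phi>)"
  then have "\<forall>t\<subseteq>s. supports M t \<phi> \<longrightarrow> t = {}"
    by (simp add: Neg_def)
  then show "\<forall>w\<in>s. \<not> true_at M w \<phi>"
    unfolding true_at_def by blast
next
  assume "\<forall>w\<in>s. \<not> true_at M w \<phi>"
  then have "t = {}" if "t \<subseteq> s" "supports M t \<phi>" for t
    using that supports_imp_true_at[of M t \<phi>] by blast
  then show "supports M s (Neg \<phi>)"
    by (simp add: Neg_def)
qed

lemma true_at_Neg: "true_at M w (Neg \<phi>) \<longleftrightarrow> \<not> true_at M w \<phi>"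
  by (simp add: true_at_def[of M w "Neg \<phi>"] supports_Neg)

lemma supports_Neg_Neg: "supports M s (Neg (Neg \<phi>)) \<longleftrightarrow> (\<forall>w\<in>s. true_at M w \<phi>)"
  by (simp add: supports_Neg true_at_Neg)

definition And_list :: "'p form list \<Rightarrow> 'p form" where
  "And_list \<phi>s = foldr And \<phi>s (Neg Bot)"

definition InqDisj_list :: "'p form list \<Rightarrow> 'p form" where
  "InqDisj_list \<phi>s = foldr InqDisj \<phi>s Bot"

lemma supports_And_list: "supports M s (And_list \<phi>s) \<longleftrightarrow> (\<forall>\<phi>\<in>set \<phi>s. supports M s \<phi>)"
  by (induction \<phi>s) (auto simp: And_list_def supports_Neg true_at_def)

lemma supports_InqDisj_list:
  "supports M s (InqDisj_list \<phi>s) \<longleftrightarrow> s = {} \<or> (\<exists>\<phi>\<in>set \<phi>s. supports M s \<phi>)"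
  by (induction \<phi>s) (auto simp: InqDisj_list_def supports_empty)

lemma true_at_InqDisj_list: "true_at M w (InqDisj_list \<phi>s) \<longleftrightarrow> (\<exists>\<phi>\<in>set \<phi>s. true_at M w \<phi>)"
  by (simp add: true_at_def supports_InqDisj_list)

lemma world_equiv_sym: "world_equiv M w M' w' \<Longrightarrow> world_equiv M' w' M w"
  by (simp add: world_equiv_def)

lemma state_equiv_sym: "state_equiv M s M' s' \<Longrightarrow> state_equiv M' s' M s"
  by (simp add: state_equiv_def)

lemma world_separation:
  assumes "\<not> world_equiv M w M' w'"
  shows "\<exists>\<alpha>. true_at M w \<alpha> \<and> \<not> true_at M' w' \<alpha>"
proof -
  obtain \<alpha> where "true_at M w \<alpha> \<noteq> true_at M' w' \<alpha>"
    using assms unfolding world_equiv_def by blast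
  then consider "true_at M w \<alpha>" "\<not> true_at M' w' \<alpha>"
    | "true_at M w (Neg \<alpha>)" "\<not> true_at M' w' (Neg \<alpha>)"
    using true_at_Neg[of M w \<alpha>] true_at_Neg[of M' w' \<alpha>] by blast
  then show ?thesis
    by cases blast+
qed

lemma state_world_separation:
  assumes "finite s" and "\<forall>w\<in>s. \<not> world_equiv M w M' w'"
  shows "\<exists>\<alpha>. supports M s \<alpha> \<and> \<not> true_at M' w' \<alpha>"
proof -
  obtain ws where ws: "set ws = s"
    using finite_list[OF assms(1)] by blast
  obtain \<beta> where \<beta>: "\<forall>w\<in>s. true_at M w (\<beta> w) \<and> \<not> true_at M' w' (\<beta> w)"
    using assms(2) world_separation[of M _ M' w'] by metis
  let ?\<alpha> = "InqDisj_list (map \<beta> ws)"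
  have "supports M s (Neg (Neg ?\<alpha>))" "\<not> true_at M' w' (Neg (Neg ?\<alpha>))"
    using \<beta> ws by (auto simp: supports_Neg_Neg true_at_Neg true_at_InqDisj_list)
  then show ?thesis
    by blast
qed

lemma state_equiv_world_forth:
  assumes "state_equiv M s M' s'" "finite s'" "w \<in> s"
  shows "\<exists>w'\<in>s'. world_equiv M w M' w'"
proof (rule ccontr)
  assume "\<not> ?thesis"
  then have "\<forall>w'\<in>s'. \<not> world_equiv M' w' M w"
    using world_equiv_sym[of M' _ M w] by blast
  then obtain \<alpha> where "supports M' s' \<alpha>" "\<not> true_at M w \<alpha>"
    using state_world_separation[OF assms(2), of M' M w] by blast
  moreover have "supports M s \<alpha>"
    using assms(1) \<open>supports M' s' \<alpha>\<close> by (simp add: state_equiv_def)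
  ultimately show False
    using supports_imp_true_at[of M s \<alpha> w] assms(3) by blast
qed

lemma state_family_separation:
  assumes "finite T" "s \<noteq> {}" and "\<forall>t\<in>T. \<not> state_equiv M s M' t"
  shows "\<exists>\<phi> \<psi>. supports M s \<phi> \<and> \<not> supports M s \<psi> \<and>
           (\<forall>t\<in>T. supports M' t \<phi> \<longrightarrow> supports M' t \<psi>)"
proof -
  obtain ts where ts: "set ts = T"
    using finite_list[OF assms(1)] by blast
  obtain \<alpha> where \<alpha>: "\<forall>t\<in>T. supports M s (\<alpha> t) \<noteq> supports M' t (\<alpha> t)"
    using assms(3) unfolding state_equiv_def by metis
  define \<phi> where "\<phi> = And_list (filter (supports M s) (map \<alpha> ts))"
  define \<psi> where "\<psi> = InqDisj_list (filter (\<lambda>\<chi>. \<not> supports M s \<chi>) (map \<alpha> ts))"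
  have "supports M s \<phi>"
    by (simp add: \<phi>_def supports_And_list)
  moreover have "\<not> supports M s \<psi>"
    using assms(2) by (simp add: \<psi>_def supports_InqDisj_list)
  moreover have "supports M' t \<psi>" if "t \<in> T" "supports M' t \<phi>" for t
  proof -
    have "\<not> supports M s (\<alpha> t)"
      using that \<alpha> ts by (auto simp: \<phi>_def supports_And_list)
    then show ?thesis
      using that(1) \<alpha> ts by (auto simp: \<psi>_def supports_InqDisj_list)
  qed
  ultimately show ?thesis
    by blast
qed

lemma world_equiv_nbhds_forth:
  assumes "world_equiv M w M' w'" "finite (nbhds M' w')" "s \<in> nbhds M w" "s \<noteq> {}"
  shows "\<exists>s'\<in>nbhds M' w'. state_equiv M s M' s'"
proof (rule ccontr)
  assume "\<not> ?thesis"
  then obtain \<phi> \<psi> where "supports M s \<phi>" "\<not> supports M s \<psi>"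
    "\<forall>s'\<in>nbhds M' w'. supports M' s' \<phi> \<longrightarrow> supports M' s' \<psi>"
    using state_family_separation[OF assms(2,4), of M M'] by blast
  then have "true_at M' w' (InqCond \<phi> \<psi>)" "\<not> true_at M w (InqCond \<phi> \<psi>)"
    using assms(3) by (auto simp: true_at_def)
  then show False
    using assms(1) by (simp add: world_equiv_def)
qed

lemma image_finite_nbhds:
  assumes "image_finite M" "w \<in> worlds M"
  shows "finite (nbhds M w)" and "s \<in> nbhds M w \<Longrightarrow> finite s"
proof -
  have fin: "finite (\<Union>(nbhds M w))"
    using assms by (simp add: image_finite_def)
  then show "finite (nbhds M w)"
    by (rule finite_UnionD)
  show "finite s" if "s \<in> nbhds M w"
    using Union_upper[OF that] fin by (rule finite_subset)
qed

lemma in_model_nbhds: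
  assumes "in_model M" "w \<in> worlds M" "s \<in> nbhds M w"
  shows "s \<noteq> {}" and "s \<subseteq> worlds M"
  using assms by (auto simp: in_model_def)

definition world_equiv_rel ::
  "('w, 'p) in_struct \<Rightarrow> ('v, 'p) in_struct \<Rightarrow> 'w \<Rightarrow> 'v \<Rightarrow> bool" where
  "world_equiv_rel M M' w w' \<longleftrightarrow> w \<in> worlds M \<and> w' \<in> worlds M' \<and> world_equiv M w M' w'"

lemma world_equiv_rel_sym: "world_equiv_rel M M' w w' \<Longrightarrow> world_equiv_rel M' M w' w"
  by (simp add: world_equiv_rel_def world_equiv_sym)

lemma rel_set_world_equiv_rel_sym:
  "rel_set (world_equiv_rel M M') s s' \<Longrightarrow> rel_set (world_equiv_rel M' M) s' s"
  unfolding rel_set_def using world_equiv_rel_sym[of M M'] by blast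

lemma state_equiv_imp_rel_set:
  assumes "state_equiv M s M' s'" "finite s" "finite s'" "s \<subseteq> worlds M" "s' \<subseteq> worlds M'"
  shows "rel_set (world_equiv_rel M M') s s'"
proof (rule rel_setI)
  fix w assume "w \<in> s"
  then show "\<exists>w'\<in>s'. world_equiv_rel M M' w w'"
    using state_equiv_world_forth[OF assms(1,3)] assms(4,5) unfolding world_equiv_rel_def by blast
next
  fix w' assume w': "w' \<in> s'"
  obtain w where "w \<in> s" "world_equiv M' w' M w"
    using state_equiv_world_forth[OF state_equiv_sym[OF assms(1)] assms(2) w'] by blast
  then show "\<exists>w\<in>s. world_equiv_rel M M' w w'"
    using w' assms(4,5) world_equiv_sym[of M' w' M w] unfolding world_equiv_rel_def by blast
qed

lemma world_equiv_rel_forth: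
  assumes "in_model M" "in_model M'" "image_finite M" "image_finite M'"
    and "world_equiv_rel M M' w w'" "s \<in> nbhds M w"
  shows "\<exists>s'\<in>nbhds M' w'. rel_set (world_equiv_rel M M') s s'"
proof -
  have w: "w \<in> worlds M" "w' \<in> worlds M'" "world_equiv M w M' w'"
    using assms(5) by (simp_all add: world_equiv_rel_def)
  obtain s' where s': "s' \<in> nbhds M' w'" "state_equiv M s M' s'"
    using world_equiv_nbhds_forth[OF w(3) image_finite_nbhds(1)[OF assms(4) w(2)] assms(6)]
      in_model_nbhds(1)[OF assms(1) w(1) assms(6)] by blast
  have "finite s" "finite s'"
    using image_finite_nbhds(2)[OF assms(3) w(1) assms(6)]
      image_finite_nbhds(2)[OF assms(4) w(2) s'(1)] .
  moreover have "s \<subseteq> worlds M" "s' \<subseteq> worlds M'"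
    using in_model_nbhds(2)[OF assms(1) w(1) assms(6)]
      in_model_nbhds(2)[OF assms(2) w(2) s'(1)] .
  ultimately have "rel_set (world_equiv_rel M M') s s'"
    by (rule state_equiv_imp_rel_set[OF s'(2)])
  then show ?thesis
    using s'(1) by blast
qed

lemma bisimulation_world_equiv_rel:
  assumes "in_model M" "in_model M'" "image_finite M" "image_finite M'"
    and "world_equiv_rel M M' w w'"
  shows "bisimulation M M' (world_equiv_rel M M')"
  unfolding bisimulation_def
proof (intro conjI allI impI ballI)
  show "\<exists>w w'. world_equiv_rel M M' w w'"
    using assms(5) by blast
next
  fix v v' assume v: "world_equiv_rel M M' v v'"
  then show "v \<in> worlds M" "v' \<in> worlds M'"
    by (simp_all add: world_equiv_rel_def)
  have "true_at M v (Atom p) \<longleftrightarrow> true_at M' v' (Atom p)" for p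
    using v by (simp add: world_equiv_rel_def world_equiv_def)
  then show "val M v p \<longleftrightarrow> val M' v' p" for p
    by (simp add: true_at_def)
  show "\<exists>s'\<in>nbhds M' v'. rel_set (world_equiv_rel M M') s s'" if "s \<in> nbhds M v" for s
    using world_equiv_rel_forth[OF assms(1-4) v that] .
  show "\<exists>s\<in>nbhds M v. rel_set (world_equiv_rel M M') s s'" if "s' \<in> nbhds M' v'" for s'
    using world_equiv_rel_forth[OF assms(2,1,4,3) world_equiv_rel_sym[OF v] that]
      rel_set_world_equiv_rel_sym[of M' M] by blast
qed

theorem theorem5p12:
  fixes M :: "('w, 'p) in_struct" and M' :: "('v, 'p) in_struct"
  assumes "in_model M" and "in_model M'"
    and "image_finite M" and "image_finite M'"
  shows "(\<forall>w\<in>worlds M. \<forall>w'\<in>worlds M'.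
            world_equiv M w M' w' \<longrightarrow> world_bisimilar M w M' w') \<and>
         (\<forall>s s'. s \<subseteq> worlds M \<and> s' \<subseteq> worlds M' \<and> finite s \<and> finite s' \<and>
            (s \<noteq> {} \<or> s' \<noteq> {}) \<and> state_equiv M s M' s' \<longrightarrow> state_bisimilar M s M' s')"
proof (intro conjI ballI allI impI)
  fix w w' assume "w \<in> worlds M" "w' \<in> worlds M'" "world_equiv M w M' w'"
  then have "world_equiv_rel M M' w w'"
    by (simp add: world_equiv_rel_def)
  then show "world_bisimilar M w M' w'"
    using bisimulation_world_equiv_rel[OF assms, of w w'] unfolding world_bisimilar_def by blast
next
  fix s s'
  assume states: "s \<subseteq> worlds M \<and> s' \<subseteq> worlds M' \<and> finite s \<and> finite s' \<and>
    (s \<noteq> {} \<or> s' \<noteq> {}) \<and> state_equiv M s M' s'"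
  then have rel: "rel_set (world_equiv_rel M M') s s'"
    by (simp add: state_equiv_imp_rel_set)
  then obtain w w' where "world_equiv_rel M M' w w'"
    using states unfolding rel_set_def by blast
  then show "state_bisimilar M s M' s'"
    using bisimulation_world_equiv_rel[OF assms, of w w'] rel unfolding state_bisimilar_def by blast
qed

end
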